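(* Let $\nu=\nu_1=\cdots=\nu_n$ have bounded support in $B_Y(0,R)$, let $F=(F_1,\dots,F_n)$ be an i.i.d. vector of random functionals, $F_i=F_i(\omega_i)$, and let $\beta=\beta_1=\cdots=\beta_n$ where $$\beta_i=\sup_{y\in Y,\,y\neq 0,\ \omega\in\Omega^X}\frac{|D_yF_i(\omega)|}{|y|_Y}.$$ Let $$\tilde\alpha_R^2=\left(8\beta^2+\frac{2\beta^4R^2}{(E[|F_1|])^2}\right)\int_Y|y|_Y^2\,\nu(dy).$$ Then for all $\lambda$ with $0<\lambda<\beta^2R^2/(e\,\tilde\alpha_R^2)$, $$E\left[\exp\left(\frac{|F|_2}{\beta R}\log_+\frac{\lambda|F|_2}{\beta R}\right)\right]<\infty .$$
   Context: $Y$ is a normed linear space with norm $|\cdot|_Y$ and $B_Y(0,R)=\{y\in Y:|y|_Y\le R\}$; $\nu_1,\dots,\nu_n$ are diffuse Radon measures on $Y$, $X=\{1,\dots,n\}\times Y$ with intensity $d\nu_i(y)$ on $\{i\}\times Y$. $\Omega^X\simeq\Omega^Y\times\cdots\times\Omega^Y$, $\omega=(\omega_1,\dots,\omega_n)$, is the configuration space, and under $P$ the $\omega_i$ are independent Poisson configurations on $Y$ with intensities $\nu_i$. Each $F_i$ depends only on $\omega_i$, and $D_yF_i(\omega)=F_i(\omega_i\cup\{y\})-F_i(\omega_i)$. $|\cdot|_2$ is the Euclidean norm on $\mathbb R^n$ and $\log_+x=\max(\log x,0)$, $x>0$. *)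

theory Defs
  imports "HOL-Probability.Probability"
begin

text \<open>Radon measure in the sense of Bourbaki and Schwartz: a locally finite Borel measure that is
  inner regular with respect to compact sets.  On a metric space, local finiteness may equivalently
  be replaced here by finiteness on compact sets.\<close>

definition radon_measure :: "'a::t2_space measure \<Rightarrow> bool" where
  "radon_measure \<nu> \<longleftrightarrow>
     sets \<nu> = sets borel \<and>
     (\<forall>x. \<exists>U. open U \<and> x \<in> U \<and> emeasure \<nu> U < \<infinity>) \<and>
     (\<forall>A\<in>sets borel. emeasure \<nu> A = (SUP K\<in>{K. compact K \<and> K \<subseteq> A}. emeasure \<nu> K))"

definition diffuse :: "'a measure \<Rightarrow> bool" where
  "diffuse \<nu> \<longleftrightarrow> (\<forall>x. emeasure \<nu> {x} = 0)"

definition measure_support :: "'a::topological_space measure \<Rightarrow> 'a set" where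
  "measure_support \<nu> = {x. \<forall>U. open U \<longrightarrow> x \<in> U \<longrightarrow> emeasure \<nu> U > 0}"

text \<open>A configuration is a simple Radon point measure, identified with its set of atoms.\<close>

definition configurations :: "'a::topological_space set set" where
  "configurations = {\<omega>. \<forall>K. compact K \<longrightarrow> finite (\<omega> \<inter> K)}"

text \<open>The number of points in a non-compact Borel set may be infinite.\<close>

definition num_points :: "'a set \<Rightarrow> 'a set \<Rightarrow> ennreal" where
  "num_points \<omega> A = emeasure (count_space UNIV) (\<omega> \<inter> A)"

definition config_space :: "'a::topological_space set measure" where
  "config_space = sigma configurations
     {{\<omega> \<in> configurations. num_points \<omega> A \<in> B} | A B. A \<in> sets borel \<and> B \<in> sets borel}"

definition poisson_configuration ::
    "'b measure \<Rightarrow> 'a::topological_space measure \<Rightarrow> ('b \<Rightarrow> 'a set) \<Rightarrow> bool" where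
  "poisson_configuration M \<nu> \<xi> \<longleftrightarrow>
     \<xi> \<in> measurable M config_space \<and>
     (\<forall>A\<in>sets borel. emeasure \<nu> A < \<infinity> \<longrightarrow>
        (\<forall>k. measure M {x \<in> space M. num_points (\<xi> x) A = of_nat k} =
             exp (- measure \<nu> A) * measure \<nu> A ^ k / fact k)) \<and>
     (\<forall>(I :: nat set) A.
        finite I \<longrightarrow> disjoint_family_on A I \<longrightarrow>
        (\<forall>i\<in>I. A i \<in> sets borel \<and> emeasure \<nu> (A i) < \<infinity>) \<longrightarrow>
        prob_space.indep_vars M (\<lambda>_. borel) (\<lambda>i x. num_points (\<xi> x) (A i)) I)"

definition add_one_cost :: "'a \<Rightarrow> ('a set \<Rightarrow> real) \<Rightarrow> 'a set \<Rightarrow> real" where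
  "add_one_cost y f \<omega> = f (\<omega> \<union> {y}) - f \<omega>"

text \<open>The supremum runs over every configuration, not just almost every one.\<close>

definition sup_gradient :: "('a::real_normed_vector set \<Rightarrow> real) \<Rightarrow> ennreal" where
  "sup_gradient f =
     (SUP y\<in>{y. y \<noteq> 0}. SUP \<omega>\<in>configurations. ennreal (\<bar>add_one_cost y f \<omega>\<bar> / norm y))"

text \<open>At \<open>x = 0\<close> the value is \<open>0\<close>, because \<open>ln 0 = 0\<close>.\<close>

definition log_plus :: "real \<Rightarrow> real" where
  "log_plus x = max (ln x) 0"

end

theory Submission
  imports Defs "HOL-Real_Asymp.Real_Asymp"
begin

text \<open>Adding the points of a configuration one at a time gives
  \<open>|F\<^sub>i(\<omega>\<^sub>i)| \<le> |F\<^sub>i(\<emptyset>)| + \<beta> \<Sum>y\<in>\<omega>\<^sub>i. |y|\<close>, so \<open>X\<^sub>i = |F\<^sub>i|/(\<beta>R)\<close> is bounded by a constant plus a compound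
  Poisson sum with jumps \<open>r = |y|/R \<le> 1\<close>.  By \<open>e\<^bsup>tr\<^esup> - 1 \<le> tr + r\<^sup>2e\<^bsup>t\<^esup>\<close> its Laplace transform is at most
  \<open>exp(tB + Ve\<^bsup>t\<^esup>)\<close>, where \<open>V\<close> is the second moment of the jumps, and Chernoff's bound yields tails of
  order \<open>(eV/x)\<^sup>x\<close> up to lower order factors.  The condition on \<open>\<lambda>\<close> forces \<open>8e\<lambda>V < 1\<close>, already through
  the summand \<open>8\<beta>\<^sup>2\<close> of \<open>\<alpha>\<close>, and hence \<open>exp(X\<^sub>i log\<^sub>+(e\<lambda>X\<^sub>i))\<close> is integrable.  The spare factor \<open>e\<close>
  pays for the passage to the Euclidean norm: pointwise,
  \<open>T log\<^sub>+(\<lambda>T) \<le> \<Sum>i. (X\<^sub>i log\<^sub>+(e\<lambda>X\<^sub>i) + 1/\<lambda>)\<close> for \<open>T = |X|\<^sub>2\<close>, and independence finishes the proof.\<close>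

section \<open>The function \<open>log_plus\<close> and the passage to the Euclidean norm\<close>

lemma log_plus_nonneg: "0 \<le> log_plus x"
  by (simp add: log_plus_def)

lemma log_plus_eq_ln: "1 \<le> x \<Longrightarrow> log_plus x = ln x"
  by (simp add: log_plus_def)

lemma log_plus_eq_0: "0 \<le> x \<Longrightarrow> x \<le> 1 \<Longrightarrow> log_plus x = 0"
  by (cases "x = 0") (auto simp: log_plus_def ln_le_zero_iff)

lemma log_plus_mono:
  assumes "0 \<le> x" "x \<le> y"
  shows "log_plus x \<le> log_plus y"
proof (cases "x = 0")
  case False
  then have "ln x \<le> ln y" using assms by simp
  then show ?thesis by (simp add: log_plus_def)
qed (simp add: log_plus_def)

lemma mult_log_plus_mono:
  assumes "0 \<le> c" "0 \<le> x" "x \<le> y"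
  shows "x * log_plus (c * x) \<le> y * log_plus (c * y)"
  using assms by (intro mult_mono log_plus_mono mult_left_mono) (auto simp: log_plus_nonneg)

text \<open>Writing \<open>T = (\<Sum>i\<in>I. (X i)\<^sup>2) / T\<close> spreads
  \<open>T * ln (l * T)\<close> over the coordinates, and the terms are compared one by one.
  Replacing \<open>T\<close> by \<open>X i\<close> inside the logarithm costs at most
  \<open>X i\<close>, which is the factor \<open>exp 1\<close>; a coordinate below
  \<open>1 / l\<close> costs at most the constant \<open>1 / l\<close>.\<close>

lemma L2_set_mult_log_plus_le:
  assumes I: "finite I" and X: "\<And>i. i \<in> I \<Longrightarrow> 0 \<le> X i" and l: "0 < l"
  shows "L2_set X I * log_plus (l * L2_set X I) \<le> (\<Sum>i\<in>I. X i * log_plus (exp 1 * l * X i) + 1 / l)"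
proof -
  define T where "T = L2_set X I"
  have T0: "0 \<le> T" by (simp add: T_def L2_set_nonneg)
  have rhs: "0 \<le> X i * log_plus (exp 1 * l * X i) + 1 / l" if "i \<in> I" for i
    using X[OF that] l by (simp add: log_plus_nonneg)
  show ?thesis
  proof (cases "l * T \<le> 1")
    case True
    then have "log_plus (l * T) = 0" using l T0 by (simp add: log_plus_eq_0)
    then show ?thesis using rhs by (simp add: sum_nonneg flip: T_def)
  next
    case False
    then have T: "0 < T" using T0 by (cases "T = 0") auto
    have "T * ln (l * T) = T\<^sup>2 / T * ln (l * T)" using T by (simp add: power2_eq_square)
    also have "T\<^sup>2 = (\<Sum>i\<in>I. (X i)\<^sup>2)"
      unfolding T_def L2_set_def by (simp add: sum_nonneg)
    also have "\<dots> / T * ln (l * T) = (\<Sum>i\<in>I. (X i)\<^sup>2 / T * ln (l * T))"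
      by (simp add: sum_divide_distrib sum_distrib_right)
    also have "\<dots> \<le> (\<Sum>i\<in>I. X i * log_plus (exp 1 * l * X i) + 1 / l)"
    proof (rule sum_mono)
      fix i assume i: "i \<in> I"
      define x where "x = X i"
      have x: "0 \<le> x" "x \<le> T"
        using X[OF i] member_le_L2_set[OF I i, of X] by (auto simp: x_def T_def)
      show "(X i)\<^sup>2 / T * ln (l * T) \<le> X i * log_plus (exp 1 * l * X i) + 1 / l"
      proof (cases "l * x \<ge> 1")
        case True
        then have x0: "0 < x" using x by (cases "x = 0") auto
        \<comment> \<open>After multiplication by \<open>x\<^sup>2 / T\<close>, the bound
          \<open>T / x\<close> for \<open>ln (T / x)\<close> contributes exactly
          \<open>x = x * ln (exp 1)\<close>, which the logarithm on the right absorbs.\<close>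
        have "ln (l * T) = ln (l * x) + ln (T / x)"
          using l T x0 by (simp add: ln_mult ln_div)
        also have "\<dots> \<le> ln (l * x) + T / x"
          using ln_le_minus_one[of "T / x"] T x0 by simp
        finally have "x\<^sup>2 / T * ln (l * T) \<le> x\<^sup>2 / T * (ln (l * x) + T / x)"
          using T by (intro mult_left_mono) auto
        also have "\<dots> = x * (x / T * ln (l * x)) + x"
          using T x0 by (simp add: field_simps power2_eq_square)
        also have "x / T * ln (l * x) \<le> 1 * ln (l * x)"
          using T x True by (intro mult_right_mono) auto
        also have "x * (1 * ln (l * x)) + x = x * ln (exp 1 * l * x)"
          using l x0 by (simp add: ln_mult algebra_simps)
        also have "\<dots> \<le> x * log_plus (exp 1 * l * x)"
          using x by (intro mult_left_mono) (auto simp: log_plus_def)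
        finally show ?thesis using l x by (simp add: x_def mult_left_mono add_increasing2)
      next
        \<comment> \<open>Here \<open>ln (l * T) \<le> l * T\<close> suffices: the term is at most
          \<open>(l * x)\<^sup>2 / l\<close>, hence at most \<open>1 / l\<close>.\<close>
        case lx: False
        have "x\<^sup>2 / T * ln (l * T) \<le> x\<^sup>2 / T * (l * T)"
          using T l ln_le_minus_one[of "l * T"] by (intro mult_left_mono) auto
        also have "\<dots> = (l * x) * (l * x) / l" using T l by (simp add: power2_eq_square)
        also have "\<dots> \<le> 1 * 1 / l"
          using lx l x by (intro divide_right_mono mult_mono) auto
        also have "\<dots> \<le> x * log_plus (exp 1 * l * x) + 1 / l"
          using x by (simp add: log_plus_nonneg)
        finally show ?thesis by (simp add: x_def)
      qed
    qed
    finally show ?thesis using False by (simp add: log_plus_eq_ln flip: T_def)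
  qed
qed

section \<open>Scalar estimates for the Laplace transform and for Chernoff's exponent\<close>

text \<open>In the exponential series every term of order at least 2 contains
  \<open>w\<^sup>2\<close> times a further power of \<open>w\<close>, which is at most 1. The linear
  term is kept apart so that only the second moment of the jumps gets multiplied by
  \<open>exp t\<close>.\<close>

lemma exp_mult_le_quadratic:
  fixes t w :: real
  assumes "0 \<le> t" "0 \<le> w" "w \<le> 1"
  shows "exp (t * w) - 1 \<le> t * w + w\<^sup>2 * exp t"
proof -
  have e: "(\<lambda>n. x ^ (n + 2) /\<^sub>R fact (n + 2)) sums (exp x - 1 - x)" for x :: real
    using sums_split_initial_segment[OF exp_converges[of x], of 2]
    by (simp add: numeral_2_eq_2 algebra_simps)
  have "exp (t * w) - 1 - t * w \<le> w\<^sup>2 * (exp t - 1 - t)"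
  proof (rule sums_le[OF _ e sums_mult[OF e]])
    fix n
    have "(t * w) ^ (n + 2) = t ^ (n + 2) * w\<^sup>2 * w ^ n"
      by (simp add: power_mult_distrib power_add power2_eq_square)
    also have "\<dots> \<le> t ^ (n + 2) * w\<^sup>2 * 1"
      using assms by (intro mult_left_mono power_le_one) auto
    finally show "(t * w) ^ (n + 2) /\<^sub>R fact (n + 2) \<le> w\<^sup>2 * (t ^ (n + 2) /\<^sub>R fact (n + 2))"
      unfolding real_scaleR_def mult.left_commute[of "w\<^sup>2"]
      by (intro mult_left_mono) (simp_all add: mult.commute)
  qed
  also have "\<dots> \<le> w\<^sup>2 * exp t" using assms by (intro mult_left_mono) auto
  finally show ?thesis by simp
qed

text \<open>The exponent of Chernoff's bound at level \<open>k\<close>, with \<open>t = ln (8e\<lambda>k)\<close> and \<open>a = ln (e\<lambda>)\<close>: it is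
  asymptotic to \<open>(1 - ln 8) k\<close>.\<close>

lemma exponent_eventually_le:
  fixes a C B :: real
  shows "eventually (\<lambda>k::nat. (C + real k + 1) * (a + ln (C + real k + 1))
     - real k * (ln 8 + a + ln (real k)) + B * (ln 8 + a + ln (real k)) + real k \<le> - real k / 2) sequentially"
proof -
  \<comment> \<open>The limit \<open>1 - ln 8\<close> has to lie strictly below
    \<open>-1/2\<close>.\<close>
  have "ln (8::real) = 3 * ln 2" using ln_realpow[of 2 3] by simp
  then have ln8: "3/2 < ln (8::real)" using ln2_ge_two_thirds by simp
  have "((\<lambda>k::nat. ((C + real k + 1) * (a + ln (C + real k + 1))
     - real k * (ln 8 + a + ln (real k)) + B * (ln 8 + a + ln (real k)) + real k) / real k) \<longlongrightarrow> 1 - ln 8) sequentially"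
    by real_asymp
  then have "eventually (\<lambda>k::nat. ((C + real k + 1) * (a + ln (C + real k + 1))
     - real k * (ln 8 + a + ln (real k)) + B * (ln 8 + a + ln (real k)) + real k) / real k < -1/2) sequentially"
    by (rule order_tendstoD) (use ln8 in simp)
  with eventually_gt_at_top[of 0] show ?thesis
    by eventually_elim (simp add: field_simps)
qed

section \<open>Laplace transforms of Poisson counts and integrability from Chernoff tails\<close>

text \<open>The point masses sum to 1, so the count, which takes values in \<open>ennreal\<close>,
  is almost surely a natural number. The value 0 of \<open>enn2real\<close> at infinity therefore
  does not affect the Laplace transform, which becomes a series over the level sets
  \<open>A k\<close>.\<close>

lemma (in prob_space) poisson_count:
  fixes N :: "'a \<Rightarrow> ennreal" and a s :: real
  assumes N: "random_variable borel N"
    and pmf: "\<And>k. prob {x \<in> space M. N x = of_nat k} = exp (- a) * a ^ k / fact k"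
    and a: "0 \<le> a"
  shows AE_poisson_count: "AE x in M. N x \<in> range of_nat"
    and nn_integral_exp_poisson_count:
      "(\<integral>\<^sup>+x. ennreal (exp (s * enn2real (N x))) \<partial>M) = ennreal (exp (a * (exp s - 1)))"
proof -
  define A where "A k = {x \<in> space M. N x = of_nat k}" for k
  have A[measurable]: "A k \<in> events" for k
    unfolding A_def using N by measurable
  have disj: "disjoint_family A"
    by (auto simp: disjoint_family_on_def A_def)
  have "(\<lambda>k. prob (A k)) sums prob (\<Union>k. A k)"
    using disj by (intro finite_measure_UNION) auto
  moreover have "(\<lambda>k. exp (- a) * (a ^ k /\<^sub>R fact k)) sums (exp (- a) * exp a)"
    by (intro sums_mult exp_converges)
  moreover have "prob (A k) = exp (- a) * (a ^ k /\<^sub>R fact k)" for k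
    by (simp add: A_def pmf divide_inverse)
  moreover have "exp (- a) * exp a = 1"
    by (simp flip: exp_add)
  ultimately have "prob (\<Union>k. A k) = 1"
    using sums_unique2 by simp
  then have "AE x in M. x \<in> (\<Union>k. A k)"
    by (intro AE_prob_1)
  then show AE: "AE x in M. N x \<in> range of_nat"
    by eventually_elim (auto simp: A_def)
  have "(\<integral>\<^sup>+x. ennreal (exp (s * enn2real (N x))) \<partial>M)
      = (\<integral>\<^sup>+x. (\<Sum>k. ennreal (exp (s * real k)) * indicator (A k) x) \<partial>M)"
  proof (rule nn_integral_cong_AE)
    show "AE x in M. ennreal (exp (s * enn2real (N x)))
        = (\<Sum>k. ennreal (exp (s * real k)) * indicator (A k) x)"
      using AE AE_space
    proof eventually_elim
      case (elim x)
      then obtain j where j: "N x = of_nat j" by auto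
      have "(\<Sum>k. ennreal (exp (s * real k)) * indicator (A k) x)
          = (\<Sum>k\<in>{j}. ennreal (exp (s * real k)) * indicator (A k) x)"
        by (rule suminf_finite) (auto simp: A_def j)
      then show ?case using elim by (simp add: A_def j)
    qed
  qed
  also have "\<dots> = (\<Sum>k. \<integral>\<^sup>+x. ennreal (exp (s * real k)) * indicator (A k) x \<partial>M)"
    by (intro nn_integral_suminf) simp
  also have "\<dots> = (\<Sum>k. ennreal (exp (s * real k) * prob (A k)))"
    by (simp add: nn_integral_cmult_indicator emeasure_eq_measure ennreal_mult)
  also have "\<dots> = (\<Sum>k. ennreal (exp (- a) * ((a * exp s) ^ k /\<^sub>R fact k)))"
    by (simp add: A_def pmf power_mult_distrib exp_of_nat_mult[symmetric] divide_inverse mult_ac)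
  also have "\<dots> = ennreal (exp (- a) * exp (a * exp s))"
    using a by (intro suminf_ennreal_eq sums_mult exp_converges) auto
  also have "exp (- a) * exp (a * exp s) = exp (a * (exp s - 1))"
    by (simp add: algebra_simps flip: exp_add)
  finally show "(\<integral>\<^sup>+x. ennreal (exp (s * enn2real (N x))) \<partial>M) = ennreal (exp (a * (exp s - 1)))" .
qed

text \<open>The integral is cut at the integer levels of \<open>S\<close>, and the tail at level
  \<open>k\<close> is estimated by Chernoff's bound with a parameter depending on \<open>k\<close>.
  The resulting series is dominated by a geometric one.\<close>

lemma (in prob_space) nn_integral_exp_mult_log_plus_finite:
  fixes S :: "'a \<Rightarrow> real" and B C V l :: real
  assumes [measurable]: "random_variable borel S" and S: "\<And>x. 0 \<le> S x"
    and mgf: "\<And>t. 0 \<le> t \<Longrightarrow> (\<integral>\<^sup>+x. ennreal (exp (t * S x)) \<partial>M) \<le> ennreal (exp (t * B + V * exp t))"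
    and C: "0 \<le> C" and l: "0 < l" and V: "8 * exp 1 * l * V \<le> 1"
  shows "(\<integral>\<^sup>+x. ennreal (exp ((C + S x) * log_plus (exp 1 * l * (C + S x)))) \<partial>M) < \<infinity>"
proof -
  define g where "g x = x * log_plus (exp 1 * l * x)" for x
  define b where "b k = exp (g (C + real k + 1)) * prob {x \<in> space M. real k \<le> S x}" for k
  have b_nonneg: "0 \<le> b k" for k
    by (simp add: b_def)
  have tail: "prob {x \<in> space M. real k \<le> S x} \<le> exp (t * B + V * exp t - t * k)" if t: "0 \<le> t" for k t
  proof -
    have "emeasure M {x \<in> space M. real k \<le> S x} = (\<integral>\<^sup>+x. indicator {x \<in> space M. real k \<le> S x} x \<partial>M)"
      by simp
    also have "\<dots> \<le> (\<integral>\<^sup>+x. ennreal (exp (- t * k)) * ennreal (exp (t * S x)) \<partial>M)"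
      using t by (intro nn_integral_mono)
        (auto simp: indicator_def ennreal_mult[symmetric] mult_left_mono simp flip: exp_add ennreal_1)
    also have "\<dots> = ennreal (exp (- t * k)) * (\<integral>\<^sup>+x. ennreal (exp (t * S x)) \<partial>M)"
      by (intro nn_integral_cmult) simp
    also have "\<dots> \<le> ennreal (exp (- t * k)) * ennreal (exp (t * B + V * exp t))"
      using mgf[OF t] by (intro mult_left_mono) auto
    also have "\<dots> = ennreal (exp (t * B + V * exp t - t * k))"
      by (simp add: ennreal_mult[symmetric] algebra_simps flip: exp_add)
    finally show ?thesis by (simp add: emeasure_eq_measure)
  qed
  \<comment> \<open>For large \<open>k\<close> the function \<open>log_plus\<close> is
    \<open>ln\<close> at the argument in question, and the parameter \<open>t\<close> chosen below
    is nonnegative.\<close>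
  have "\<forall>\<^sub>F k in sequentially. 1 \<le> exp 1 * l * (C + real k + 1)"
    using l by real_asymp
  moreover have "\<forall>\<^sub>F k in sequentially. 1 \<le> 8 * exp 1 * l * real k"
    using l by real_asymp
  ultimately have "\<forall>\<^sub>F k in sequentially. norm (b k) \<le> exp (- real k / 2)"
    using exponent_eventually_le[of C "ln (exp 1 * l)" B] eventually_gt_at_top[of 0]
  proof eventually_elim
    case (elim k)
    \<comment> \<open>The minimum of \<open>V * exp t - t * k\<close> is at
      \<open>exp t = k / V\<close>; this is that choice for the largest admissible value
      \<open>V = 1 / (8 * exp 1 * l)\<close>. For every admissible \<open>V\<close> it gives
      \<open>V * exp t \<le> k\<close>.\<close>
    define t where "t = ln (8 * exp 1 * l * real k)"
    have t: "0 \<le> t" "exp t = 8 * exp 1 * l * real k"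
      using elim l by (auto simp: t_def)
    have t_eq: "t = ln 8 + ln (exp 1 * l) + ln (real k)"
      using elim l by (simp add: t_def ln_mult)
    have g: "g (C + real k + 1) = (C + real k + 1) * (ln (exp 1 * l) + ln (C + real k + 1))"
      using elim l C by (simp add: g_def log_plus_eq_ln ln_mult)
    have "V * exp t = (8 * exp 1 * l * V) * real k" by (simp add: t)
    also have "\<dots> \<le> 1 * real k" using V by (intro mult_right_mono) auto
    finally have Vt: "V * exp t \<le> real k" by simp
    have "norm (b k) \<le> exp (g (C + real k + 1)) * exp (t * B + V * exp t - t * k)"
      using tail[OF t(1), of k] by (simp add: b_def)
    also have "\<dots> = exp (g (C + real k + 1) + (t * B + V * exp t - t * k))"
      by (simp add: exp_add)
    also have "\<dots> \<le> exp (- real k / 2)"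
      using elim(3) Vt unfolding g t_eq by (simp add: algebra_simps)
    finally show ?case .
  qed
  moreover have "summable (\<lambda>k. exp (- real k / 2))"
  proof -
    have "summable (\<lambda>k. exp (-1/2 :: real) ^ k)" by (intro summable_geometric) simp
    then show ?thesis by (simp flip: exp_of_nat_mult)
  qed
  ultimately have sum: "summable b" by (rule summable_comparison_test_ev)
  have "(\<integral>\<^sup>+x. ennreal (exp (g (C + S x))) \<partial>M)
      \<le> (\<integral>\<^sup>+x. (\<Sum>k. ennreal (exp (g (C + real k + 1))) * indicator {x \<in> space M. real k \<le> S x} x) \<partial>M)"
  proof (rule nn_integral_mono)
    fix x assume x: "x \<in> space M"
    \<comment> \<open>The single summand at the integer part of \<open>S x\<close> already
      dominates, because \<open>g\<close> is monotone on the nonnegative reals and is evaluated at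
      the upper end \<open>k + 1\<close>.\<close>
    define k where "k = nat \<lfloor>S x\<rfloor>"
    have k: "real k \<le> S x" "S x \<le> real k + 1"
      using S[of x] by (auto simp: k_def)
    have "ennreal (exp (g (C + S x))) \<le> ennreal (exp (g (C + real k + 1)))"
      unfolding g_def using k C S[of x] l
      by (intro ennreal_leI exp_le_cancel_iff[THEN iffD2] mult_log_plus_mono) auto
    also have "\<dots> = (\<Sum>k\<in>{k}. ennreal (exp (g (C + real k + 1))) * indicator {x \<in> space M. real k \<le> S x} x)"
      using k x by simp
    also have "\<dots> \<le> (\<Sum>k. ennreal (exp (g (C + real k + 1))) * indicator {x \<in> space M. real k \<le> S x} x)"
      by (intro sum_le_suminf) auto
    finally show "ennreal (exp (g (C + S x))) \<le> \<dots>" .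
  qed
  also have "\<dots> = (\<Sum>k. \<integral>\<^sup>+x. ennreal (exp (g (C + real k + 1))) * indicator {x \<in> space M. real k \<le> S x} x \<partial>M)"
    by (intro nn_integral_suminf) simp
  also have "\<dots> = (\<Sum>k. ennreal (b k))"
    by (simp add: b_def nn_integral_cmult_indicator emeasure_eq_measure ennreal_mult)
  also have "\<dots> < \<infinity>"
    using ennreal_suminf_neq_top[OF sum b_nonneg] by (simp add: top.not_eq_extremum)
  finally show ?thesis by (simp add: g_def)
qed

text \<open>Counts on disjoint sets are independent, so the Laplace transform factorizes into
  Poisson transforms. In the exponents \<open>exp (t * w j) - 1\<close> is then replaced by the
  bound of \<open>exp_mult_le_quadratic\<close>.\<close>

lemma (in prob_space) nn_integral_exp_weighted_counts_le:
  fixes \<nu> :: "'b::topological_space measure" and w :: "nat \<Rightarrow> real"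
  assumes \<xi>: "poisson_configuration M \<nu> \<xi>"
    and J: "finite J" and disj: "disjoint_family_on A J"
    and A: "\<And>j. j \<in> J \<Longrightarrow> A j \<in> sets borel" "\<And>j. j \<in> J \<Longrightarrow> emeasure \<nu> (A j) < \<infinity>"
    and w: "\<And>j. j \<in> J \<Longrightarrow> 0 \<le> w j" "\<And>j. j \<in> J \<Longrightarrow> w j \<le> 1" and t: "0 \<le> t"
  shows "(\<integral>\<^sup>+x. ennreal (exp (t * (\<Sum>j\<in>J. w j * enn2real (num_points (\<xi> x) (A j))))) \<partial>M)
    \<le> ennreal (exp (t * (\<Sum>j\<in>J. w j * measure \<nu> (A j)) + (\<Sum>j\<in>J. (w j)\<^sup>2 * measure \<nu> (A j)) * exp t))"
proof -
  have indep: "indep_vars (\<lambda>_. borel) (\<lambda>j x. num_points (\<xi> x) (A j)) J"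
    using \<xi> J disj A unfolding poisson_configuration_def by auto
  have "(\<integral>\<^sup>+x. ennreal (exp (t * (\<Sum>j\<in>J. w j * enn2real (num_points (\<xi> x) (A j))))) \<partial>M)
      = (\<integral>\<^sup>+x. (\<Prod>j\<in>J. ennreal (exp (t * w j * enn2real (num_points (\<xi> x) (A j))))) \<partial>M)"
    using J by (simp add: sum_distrib_left exp_sum prod_ennreal mult.assoc)
  also have "\<dots> = (\<Prod>j\<in>J. \<integral>\<^sup>+x. ennreal (exp (t * w j * enn2real (num_points (\<xi> x) (A j)))) \<partial>M)"
    by (intro indep_vars_nn_integral J indep_vars_compose2[OF indep]) simp_all
  also have "\<dots> = (\<Prod>j\<in>J. ennreal (exp (measure \<nu> (A j) * (exp (t * w j) - 1))))"
  proof (rule prod.cong[OF refl])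
    fix j assume j: "j \<in> J"
    show "(\<integral>\<^sup>+x. ennreal (exp (t * w j * enn2real (num_points (\<xi> x) (A j)))) \<partial>M)
        = ennreal (exp (measure \<nu> (A j) * (exp (t * w j) - 1)))"
    proof (rule nn_integral_exp_poisson_count)
      show "random_variable borel (\<lambda>x. num_points (\<xi> x) (A j))"
        using indep j by (auto simp: indep_vars_def)
      show "prob {x \<in> space M. num_points (\<xi> x) (A j) = of_nat k}
          = exp (- measure \<nu> (A j)) * measure \<nu> (A j) ^ k / fact k" for k
        using \<xi> A[OF j] unfolding poisson_configuration_def by auto
    qed simp
  qed
  also have "\<dots> = ennreal (exp (\<Sum>j\<in>J. measure \<nu> (A j) * (exp (t * w j) - 1)))"
    using J by (simp add: exp_sum prod_ennreal)
  also have "(\<Sum>j\<in>J. measure \<nu> (A j) * (exp (t * w j) - 1))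
      \<le> (\<Sum>j\<in>J. measure \<nu> (A j) * (t * w j + (w j)\<^sup>2 * exp t))"
    using w t by (intro sum_mono mult_left_mono exp_mult_le_quadratic) auto
  also have "\<dots> = t * (\<Sum>j\<in>J. w j * measure \<nu> (A j)) + (\<Sum>j\<in>J. (w j)\<^sup>2 * measure \<nu> (A j)) * exp t"
    by (simp add: sum_distrib_left sum_distrib_right sum.distrib algebra_simps)
  finally show ?thesis by (simp add: ennreal_leI)
qed

section \<open>Pathwise bound by the sum of the norms of the points\<close>

lemma finite_in_configurations: "finite \<omega> \<Longrightarrow> \<omega> \<in> configurations"
  by (simp add: configurations_def)

lemma abs_add_one_cost_le:
  assumes f: "sup_gradient f \<le> ennreal \<beta>" and \<beta>: "0 \<le> \<beta>"
    and y: "y \<noteq> 0" and \<omega>: "\<omega> \<in> configurations"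
  shows "\<bar>add_one_cost y f \<omega>\<bar> \<le> \<beta> * norm y"
proof -
  have "ennreal (\<bar>add_one_cost y f \<omega>\<bar> / norm y) \<le> sup_gradient f"
    unfolding sup_gradient_def using y \<omega> by (intro SUP_upper2[of y] SUP_upper) auto
  also note f
  finally show ?thesis using \<beta> y by (simp add: field_simps)
qed

text \<open>The points are inserted one by one; every intermediate set is finite, hence a
  configuration over which the supremum runs. The point 0 is excluded because
  \<open>sup_gradient\<close> does not control its insertion.\<close>

lemma abs_le_sum_norm:
  assumes f: "sup_gradient f \<le> ennreal \<beta>" and \<beta>: "0 \<le> \<beta>"
    and \<omega>: "finite \<omega>" "0 \<notin> \<omega>"
  shows "\<bar>f \<omega>\<bar> \<le> \<bar>f {}\<bar> + \<beta> * (\<Sum>y\<in>\<omega>. norm y)"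
  using \<omega>
proof (induction rule: finite_induct)
  case (insert y \<omega>)
  have "\<bar>add_one_cost y f \<omega>\<bar> \<le> \<beta> * norm y"
    using insert by (intro abs_add_one_cost_le f \<beta> finite_in_configurations) auto
  then show ?case using insert by (simp add: add_one_cost_def algebra_simps)
qed simp

section \<open>Discretization of the norm by shells\<close>

text \<open>Rounding the norms up to multiples of \<open>R/m\<close> replaces the compound Poisson sum by a finite
  combination of independent Poisson counts.\<close>

definition shell :: "real \<Rightarrow> nat \<Rightarrow> nat \<Rightarrow> 'a::real_normed_vector set" where
  "shell R m j = {y. R * (real j - 1) / m < norm y \<and> norm y \<le> R * real j / m}"

lemma shell_borel [measurable]: "shell R m j \<in> sets borel"
  unfolding shell_def by measurable

lemma shell_unique:
  assumes y: "y \<in> shell R m j" "y \<in> shell R m k" and R: "0 < R" and m: "0 < m"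
  shows "j = k"
proof -
  have "R * (real j - 1) / m < R * real k / m" "R * (real k - 1) / m < R * real j / m"
    using y by (auto simp: shell_def)
  then have "real j - 1 < real k" "real k - 1 < real j"
    using R m by (auto simp: divide_less_cancel)
  then show ?thesis by linarith
qed

lemma disjoint_shells: "0 < R \<Longrightarrow> 0 < m \<Longrightarrow> disjoint_family_on (shell R m) J"
  unfolding disjoint_family_on_def using shell_unique by blast

lemma shells_cover:
  assumes y: "norm y \<le> R" "y \<noteq> 0" and R: "0 < R" and m: "0 < m"
  shows "\<exists>j\<in>{1..m}. y \<in> shell R m j"
proof -
  define x where "x = m * norm y / R"
  have x: "0 < x" "x \<le> m" using y R m by (auto simp: x_def field_simps)
  \<comment> \<open>Shells are closed at the outer radius, hence the ceiling. Shell 0 is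
    \<open>{0}\<close>, so \<open>y \<noteq> 0\<close> gives \<open>1 \<le> j\<close>.\<close>
  define j where "j = nat \<lceil>x\<rceil>"
  have j: "real j - 1 < x" "x \<le> real j" using x unfolding j_def by linarith+
  have "1 \<le> j" "j \<le> m" using x j by linarith+
  moreover have "norm y = R * x / m" using R m by (simp add: x_def)
  ultimately show ?thesis using j R m
    by (intro bexI[of _ j]) (auto simp: shell_def divide_less_cancel divide_le_cancel)
qed

text \<open>Every point is charged the outer radius of its shell; exchanging the two sums turns the
  charges into counts.\<close>

lemma sum_norm_le_weighted_counts:
  assumes \<omega>: "finite \<omega>" "\<omega> \<subseteq> cball 0 R" "0 \<notin> \<omega>" and R: "0 < R" and m: "0 < m"
  shows "(\<Sum>y\<in>\<omega>. norm y) \<le> R * (\<Sum>j\<in>{1..m}. real j / m * enn2real (num_points \<omega> (shell R m j)))"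
proof -
  have "(\<Sum>y\<in>\<omega>. norm y) \<le> (\<Sum>y\<in>\<omega>. \<Sum>j\<in>{1..m}. R * real j / m * indicator (shell R m j) y)"
  proof (rule sum_mono)
    fix y assume y: "y \<in> \<omega>"
    then have "\<exists>j\<in>{1..m}. y \<in> shell R m j"
      using \<omega> by (intro shells_cover R m) auto
    then obtain j where j: "j \<in> {1..m}" "y \<in> shell R m j" by blast
    have "norm y \<le> R * real j / m * indicator (shell R m j) y"
      using j by (simp add: shell_def)
    also have "\<dots> \<le> (\<Sum>j\<in>{1..m}. R * real j / m * indicator (shell R m j) y)"
      using j R by (intro member_le_sum) auto
    finally show "norm y \<le> \<dots>" .
  qed
  also have "\<dots> = (\<Sum>j\<in>{1..m}. R * real j / m * (\<Sum>y\<in>\<omega>. indicator (shell R m j) y))"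
    by (subst sum.swap) (simp add: sum_distrib_left)
  also have "\<dots> = (\<Sum>j\<in>{1..m}. R * real j / m * enn2real (num_points \<omega> (shell R m j)))"
    using \<omega>(1) by (simp add: num_points_def emeasure_count_space indicator_def sum.If_cases Int_def)
  finally show ?thesis by (simp add: sum_distrib_left mult.assoc)
qed

text \<open>With \<open>r = norm y / R\<close>, rounding up moves \<open>r\<close> by at most
  \<open>1 / m\<close>, and \<open>(r + 1 / m)\<^sup>2 \<le> r\<^sup>2 + 3 / m\<close> because
  \<open>r\<close> and \<open>1 / m\<close> are at most 1. Integration turns the error into
  \<open>3 * K / m\<close>, which vanishes as \<open>m\<close> grows because the total mass
  \<open>K\<close> is finite.\<close>

lemma weighted_shells_le:
  fixes \<nu> :: "'a::real_normed_vector measure"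
  assumes sets: "sets \<nu> = sets borel" and K: "emeasure \<nu> UNIV = ennreal K" "0 \<le> K"
    and I2: "(\<integral>\<^sup>+y. ennreal ((norm y)\<^sup>2) \<partial>\<nu>) = ennreal I2" "0 \<le> I2"
    and R: "0 < R" and m: "0 < m"
  shows "(\<Sum>j\<in>{1..m}. (real j / m)\<^sup>2 * measure \<nu> (shell R m j)) \<le> I2 / R\<^sup>2 + 3 * K / m"
proof -
  have [measurable_cong]: "sets \<nu> = sets borel" by fact
  have space: "space \<nu> = UNIV" using sets_eq_imp_space_eq[OF sets] by simp
  interpret finite_measure \<nu>
    by standard (use K space in auto)
  have "ennreal (\<Sum>j\<in>{1..m}. (real j / m)\<^sup>2 * measure \<nu> (shell R m j))
      = (\<Sum>j\<in>{1..m}. ennreal ((real j / m)\<^sup>2) * emeasure \<nu> (shell R m j))"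
    by (subst sum_ennreal[symmetric]) (auto simp: ennreal_mult emeasure_eq_measure)
  also have "\<dots> = (\<integral>\<^sup>+y. (\<Sum>j\<in>{1..m}. ennreal ((real j / m)\<^sup>2) * indicator (shell R m j) y) \<partial>\<nu>)"
    by (subst nn_integral_sum) (auto simp: nn_integral_cmult_indicator)
  also have "\<dots> \<le> (\<integral>\<^sup>+y. ennreal (1 / R\<^sup>2) * ennreal ((norm y)\<^sup>2) + ennreal (3 / m) \<partial>\<nu>)"
  proof (rule nn_integral_mono)
    fix y :: 'a
    show "(\<Sum>j\<in>{1..m}. ennreal ((real j / m)\<^sup>2) * indicator (shell R m j) y)
        \<le> ennreal (1 / R\<^sup>2) * ennreal ((norm y)\<^sup>2) + ennreal (3 / m)"
    proof (cases "\<exists>j\<in>{1..m}. y \<in> shell R m j")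
      case False
      then show ?thesis by simp
    next
      case True
      then obtain j where j: "j \<in> {1..m}" "y \<in> shell R m j" by blast
      have uniq: "k \<notin> {1..m} - {j}" if "y \<in> shell R m k" for k
        using shell_unique[OF that j(2) R m] by simp
      define r where "r = norm y / R"
      have w: "real j / m \<le> r + 1 / m" and "r \<le> real j / m"
        using j R m by (auto simp: shell_def r_def field_simps)
      moreover have "real j / m \<le> 1" using j m by simp
      ultimately have "r \<le> 1" by linarith
      moreover have "0 \<le> r" using R by (simp add: r_def)
      ultimately have r: "0 \<le> r" "r \<le> 1" by blast+
      \<comment> \<open>By disjointness, only the shell containing \<open>y\<close>
        contributes.\<close>
      have "(\<Sum>j\<in>{1..m}. ennreal ((real j / m)\<^sup>2) * indicator (shell R m j) y)
          = (\<Sum>j\<in>{j}. ennreal ((real j / m)\<^sup>2) * indicator (shell R m j) y)"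
      proof (rule sum.mono_neutral_right)
        show "\<forall>k\<in>{1..m} - {j}. ennreal ((real k / m)\<^sup>2) * indicator (shell R m k) y = 0"
        proof
          fix k assume "k \<in> {1..m} - {j}"
          then have "y \<notin> shell R m k" using uniq by blast
          then show "ennreal ((real k / m)\<^sup>2) * indicator (shell R m k) y = 0" by simp
        qed
      qed (use j in auto)
      also have "\<dots> = ennreal ((real j / m)\<^sup>2)" using j by simp
      also have "(real j / m)\<^sup>2 \<le> (r + 1 / m)\<^sup>2"
        using w by (intro power_mono) auto
      also have "(r + 1 / m)\<^sup>2 = r\<^sup>2 + 2 * (r * (1 / m)) + 1 / m * (1 / m)"
        by (simp add: power2_eq_square algebra_simps)
      also have "\<dots> \<le> r\<^sup>2 + 2 * (1 * (1 / m)) + 1 * (1 / m)"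
        using r m by (intro add_mono mult_left_mono mult_right_mono) auto
      also have "\<dots> = 1 / R\<^sup>2 * (norm y)\<^sup>2 + 3 / m"
        by (simp add: r_def power_divide)
      also have "ennreal \<dots> = ennreal (1 / R\<^sup>2) * ennreal ((norm y)\<^sup>2) + ennreal (3 / m)"
        by (subst ennreal_plus) (auto simp: ennreal_mult[symmetric])
      finally show ?thesis by (simp add: ennreal_leI)
    qed
  qed
  also have "\<dots> = ennreal (1 / R\<^sup>2) * ennreal I2 + ennreal (3 / m) * ennreal K"
    using I2 K by (simp add: nn_integral_add nn_integral_cmult space)
  also have "\<dots> = ennreal (I2 / R\<^sup>2 + 3 * K / m)"
    using I2 K by (simp add: ennreal_mult[symmetric] ennreal_plus[symmetric] del: ennreal_plus)
  finally show ?thesis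
    using I2 K by (subst (asm) ennreal_le_iff) auto
qed

section \<open>Exponential integrability of a single functional\<close>

text \<open>The strict inequality between \<open>8 * exp 1 * l * I2\<close> and
  \<open>R\<^sup>2\<close> leaves room for the rounding error of a fine enough shell decomposition.
  The normalized functional is then almost surely at most
  \<open>\<bar>f {}\<bar> / (\<beta> * R)\<close> plus a weighted sum of counts, to which the
  Chernoff estimate applies.\<close>

lemma (in prob_space) exp_moment_poisson_functional_finite:
  fixes \<nu> :: "'b::real_normed_vector measure" and f :: "'b set \<Rightarrow> real"
  assumes \<xi>: "poisson_configuration M \<nu> \<xi>" and sets: "sets \<nu> = sets borel"
    and K: "emeasure \<nu> UNIV = ennreal K" "0 \<le> K"
    and ball: "emeasure \<nu> (- cball 0 R) = 0" and zero: "emeasure \<nu> {0} = 0"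
    and I2: "(\<integral>\<^sup>+y. ennreal ((norm y)\<^sup>2) \<partial>\<nu>) = ennreal I2" "0 \<le> I2"
    and l: "0 < l" "8 * exp 1 * l * I2 < R\<^sup>2" and R: "0 < R"
    and f: "sup_gradient f \<le> ennreal \<beta>" and \<beta>: "0 < \<beta>"
  shows "(\<integral>\<^sup>+x. ennreal (exp (\<bar>f (\<xi> x)\<bar> / (\<beta> * R)
    * log_plus (exp 1 * l * (\<bar>f (\<xi> x)\<bar> / (\<beta> * R))))) \<partial>M) < \<infinity>"
proof -
  have fin: "emeasure \<nu> A < \<infinity>" if "A \<in> sets borel" for A
  proof -
    have "emeasure \<nu> A \<le> emeasure \<nu> UNIV"
      using sets sets_eq_imp_space_eq[OF sets] by (intro emeasure_mono) auto
    then show ?thesis using K by (auto simp: less_top[symmetric] top_unique)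
  qed
  have "((\<lambda>m. 8 * exp 1 * l * (I2 / R\<^sup>2 + 3 * K / real m)) \<longlongrightarrow> 8 * exp 1 * l * (I2 / R\<^sup>2 + 0)) sequentially"
    by (intro tendsto_intros tendsto_divide_0[OF tendsto_const]
        filterlim_at_top_imp_at_infinity[OF filterlim_real_sequentially])
  moreover have "8 * exp 1 * l * (I2 / R\<^sup>2 + 0) < 1"
    using l R by (simp add: field_simps)
  ultimately have "\<forall>\<^sub>F m in sequentially. 8 * exp 1 * l * (I2 / R\<^sup>2 + 3 * K / real m) < 1"
    by (rule order_tendstoD)
  then have "\<forall>\<^sub>F m in sequentially. 8 * exp 1 * l * (I2 / R\<^sup>2 + 3 * K / real m) < 1 \<and> 0 < m"
    using eventually_gt_at_top[of 0] by (rule eventually_conj)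
  then obtain m where m: "8 * exp 1 * l * (I2 / R\<^sup>2 + 3 * K / real m) < 1" "0 < m"
    by (auto dest: eventually_happens)
  define A :: "nat \<Rightarrow> 'b set" where "A = shell R m"
  define w where "w j = real j / m" for j :: nat
  define S where "S x = (\<Sum>j\<in>{1..m}. w j * enn2real (num_points (\<xi> x) (A j)))" for x
  define B where "B = (\<Sum>j\<in>{1..m}. w j * measure \<nu> (A j))"
  define V where "V = (\<Sum>j\<in>{1..m}. (w j)\<^sup>2 * measure \<nu> (A j))"
  have A: "A j \<in> sets borel" for j by (simp add: A_def)
  have disj: "disjoint_family_on A {1..m}"
    using R m by (simp add: A_def disjoint_shells)
  have S0: "0 \<le> S x" for x by (auto simp: S_def w_def intro!: sum_nonneg)
  have mgf: "(\<integral>\<^sup>+x. ennreal (exp (t * S x)) \<partial>M) \<le> ennreal (exp (t * B + V * exp t))" if "0 \<le> t" for t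
    unfolding S_def B_def V_def using \<xi> disj A fin that m
    by (intro nn_integral_exp_weighted_counts_le) (auto simp: w_def)
  have V: "8 * exp 1 * l * V \<le> 1"
  proof -
    have "V \<le> I2 / R\<^sup>2 + 3 * K / m"
      unfolding V_def w_def A_def using sets K I2 R m(2) by (rule weighted_shells_le)
    then have "8 * exp 1 * l * V \<le> 8 * exp 1 * l * (I2 / R\<^sup>2 + 3 * K / m)"
      using l by (intro mult_left_mono) auto
    then show ?thesis using m by linarith
  qed
  have count: "random_variable borel (\<lambda>x. num_points (\<xi> x) A)
      \<and> (\<forall>k. prob {x \<in> space M. num_points (\<xi> x) A = of_nat k}
          = exp (- measure \<nu> A) * measure \<nu> A ^ k / fact k)" if "A \<in> sets borel" for A
  proof -
    \<comment> \<open>The independence clause for a one-element index set yields the measurability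
      of a single count.\<close>
    have "indep_vars (\<lambda>_. borel) (\<lambda>i x. num_points (\<xi> x) ((\<lambda>_. A) i)) {0::nat}"
      using \<xi> that fin[OF that] unfolding poisson_configuration_def
      by (auto simp: disjoint_family_on_def)
    then show ?thesis using \<xi> that fin[OF that] unfolding poisson_configuration_def
      by (auto simp: indep_vars_def)
  qed
  have [measurable]: "random_variable borel S"
  proof -
    have [measurable]: "random_variable borel (\<lambda>x. num_points (\<xi> x) (A j))" for j
      using count A by blast
    show ?thesis unfolding S_def by measurable
  qed
  \<comment> \<open>A configuration is finite only on compact sets, and a ball need not be compact.
    That \<open>\<xi> x\<close> is almost surely finite therefore comes from the finite counts on
    the finitely many shells.\<close>
  have "AE x in M. \<forall>j\<in>{1..m}. num_points (\<xi> x) (A j) \<in> range of_nat"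
    using count A by (intro AE_finite_allI AE_poisson_count) auto
  moreover have "AE x in M. num_points (\<xi> x) (- cball 0 R \<union> {0}) = 0"
  proof -
    have C: "- cball 0 R \<union> {0} \<in> sets (borel :: 'b measure)" by measurable
    have "emeasure \<nu> (- cball 0 R \<union> {0}) \<le> emeasure \<nu> (- cball 0 R) + emeasure \<nu> {0}"
      by (intro emeasure_subadditive) (auto simp: sets)
    then have "measure \<nu> (- cball 0 R \<union> {0}) = 0"
      using ball zero by (simp add: measure_def)
    \<comment> \<open>A Poisson count of mean 0 vanishes almost surely: its mass at 0 is
      \<open>exp 0 * 0 ^ 0 / fact 0 = 1\<close>.\<close>
    then have "prob {x \<in> space M. num_points (\<xi> x) (- cball 0 R \<union> {0}) = of_nat 0} = 1"
      using count[OF C] by (simp del: of_nat_0)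
    then show ?thesis by (auto dest!: AE_prob_1)
  qed
  ultimately have bound: "AE x in M. \<bar>f (\<xi> x)\<bar> / (\<beta> * R) \<le> \<bar>f {}\<bar> / (\<beta> * R) + S x"
  proof eventually_elim
    case (elim x)
    define \<omega> where "\<omega> = \<xi> x"
    have out: "\<omega> \<inter> (- cball 0 R \<union> {0}) = {}"
      using elim(2) by (auto simp: num_points_def \<omega>_def emeasure_count_space split: if_splits)
    then have \<omega>: "\<omega> \<subseteq> cball 0 R" "0 \<notin> \<omega>" by auto
    have "\<omega> \<subseteq> (\<Union>j\<in>{1..m}. \<omega> \<inter> A j)"
    proof
      fix y assume y: "y \<in> \<omega>"
      then have "norm y \<le> R" "y \<noteq> 0" using \<omega> by auto
      then show "y \<in> (\<Union>j\<in>{1..m}. \<omega> \<inter> A j)"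
        using shells_cover[OF _ _ R m(2)] y unfolding A_def by blast
    qed
    moreover have "finite (\<omega> \<inter> A j)" if j: "j \<in> {1..m}" for j
    proof (rule ccontr)
      assume "infinite (\<omega> \<inter> A j)"
      then have "num_points (\<xi> x) (A j) = \<infinity>"
        by (simp add: num_points_def \<omega>_def emeasure_count_space)
      then show False using elim(1) j by (metis imageE infinity_ennreal_def ennreal_of_nat_neq_top)
    qed
    ultimately have fin\<omega>: "finite \<omega>" by (meson finite_UN_I finite_atLeastAtMost finite_subset)
    have "\<bar>f \<omega>\<bar> \<le> \<bar>f {}\<bar> + \<beta> * (\<Sum>y\<in>\<omega>. norm y)"
      using f \<beta> fin\<omega> \<omega> by (intro abs_le_sum_norm) auto
    also have "(\<Sum>y\<in>\<omega>. norm y) \<le> R * S x"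
      unfolding S_def w_def A_def \<omega>_def[symmetric]
      by (rule sum_norm_le_weighted_counts[OF fin\<omega> \<omega> R m(2)])
    finally have "\<bar>f \<omega>\<bar> \<le> \<bar>f {}\<bar> + \<beta> * (R * S x)" using \<beta> by simp
    then show ?case using \<beta> R by (simp add: \<omega>_def field_simps)
  qed
  have "(\<integral>\<^sup>+x. ennreal (exp (\<bar>f (\<xi> x)\<bar> / (\<beta> * R) * log_plus (exp 1 * l * (\<bar>f (\<xi> x)\<bar> / (\<beta> * R))))) \<partial>M)
    \<le> (\<integral>\<^sup>+x. ennreal (exp ((\<bar>f {}\<bar> / (\<beta> * R) + S x) * log_plus (exp 1 * l * (\<bar>f {}\<bar> / (\<beta> * R) + S x)))) \<partial>M)"
    using bound
  proof (intro nn_integral_mono_AE, eventually_elim)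
    case (elim x)
    then show ?case using \<beta> R l
      by (intro ennreal_leI exp_le_cancel_iff[THEN iffD2] mult_log_plus_mono) auto
  qed
  also have "\<dots> < \<infinity>"
    using S0 mgf V \<beta> R l by (intro nn_integral_exp_mult_log_plus_finite) auto
  finally show ?thesis .
qed

section \<open>Radon measures: complement of the support and total mass\<close>

text \<open>The space need not be separable, so a countable cover by open null sets is not at hand.
  Inner regularity reduces the claim to compact subsets of \<open>A\<close>, and these are covered
  by finitely many open null sets.\<close>

lemma radon_measure_compl_support_null:
  assumes \<nu>: "radon_measure \<nu>" and A: "A \<in> sets borel" "A \<inter> measure_support \<nu> = {}"
  shows "emeasure \<nu> A = 0"
proof -
  have sets: "sets \<nu> = sets borel" using \<nu> by (simp add: radon_measure_def)
  have "emeasure \<nu> K = 0" if K: "compact K" "K \<subseteq> A" for K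
  proof -
    define \<U> where "\<U> = {U. open U \<and> emeasure \<nu> U = 0}"
    have "\<exists>U. open U \<and> x \<in> U \<and> emeasure \<nu> U = 0" if "x \<in> K" for x
    proof -
      have "x \<notin> measure_support \<nu>" using that K A by blast
      then show ?thesis by (auto simp: measure_support_def)
    qed
    then have cover: "K \<subseteq> \<Union>\<U>" by (auto simp: \<U>_def)
    have "open U" if "U \<in> \<U>" for U using that by (simp add: \<U>_def)
    with K(1) cover obtain \<V> where \<V>: "\<V> \<subseteq> \<U>" "finite \<V>" "K \<subseteq> \<Union>\<V>"
      by (rule compactE)
    have null: "(\<Union>\<V>) \<in> null_sets \<nu>"
      using \<V> by (intro null_sets.finite_Union) (auto simp: \<U>_def null_sets_def sets)
    then have "emeasure \<nu> (\<Union>\<V>) = 0" by auto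
    moreover have "emeasure \<nu> K \<le> emeasure \<nu> (\<Union>\<V>)"
      using \<V> null by (intro emeasure_mono null_setsD2)
    ultimately show ?thesis by simp
  qed
  then have "(SUP K\<in>{K. compact K \<and> K \<subseteq> A}. emeasure \<nu> K) \<le> 0"
    by (intro SUP_least) auto
  moreover have "emeasure \<nu> A = (SUP K\<in>{K. compact K \<and> K \<subseteq> A}. emeasure \<nu> K)"
    using \<nu> A by (simp add: radon_measure_def)
  ultimately have "emeasure \<nu> A \<le> 0" by (rule ord_eq_le_trans[rotated])
  then show ?thesis by simp
qed

text \<open>Local finiteness bounds the mass of a neighbourhood of 0; outside a ball of radius
  \<open>e\<close> Markov's inequality for \<open>(norm y)\<^sup>2\<close> bounds the rest.\<close>

lemma finite_if_second_moment_finite: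
  fixes \<nu> :: "'a::real_normed_vector measure"
  assumes \<nu>: "radon_measure \<nu>" and fin: "(\<integral>\<^sup>+y. ennreal ((norm y)\<^sup>2) \<partial>\<nu>) < \<infinity>"
  shows "emeasure \<nu> UNIV < \<infinity>"
proof -
  have sets[measurable_cong]: "sets \<nu> = sets borel" using \<nu> by (simp add: radon_measure_def)
  have space: "space \<nu> = UNIV" using sets_eq_imp_space_eq[OF sets] by simp
  obtain U where U: "open U" "0 \<in> U" "emeasure \<nu> U < \<infinity>"
    using \<nu> unfolding radon_measure_def by blast
  obtain e where e: "0 < e" "ball 0 e \<subseteq> U"
    using U by (meson openE)
  have "UNIV \<subseteq> U \<union> {y\<in>space \<nu>. 1 \<le> ennreal (1 / e\<^sup>2) * ennreal ((norm y)\<^sup>2)}"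
  proof
    fix y :: 'a
    show "y \<in> U \<union> {y\<in>space \<nu>. 1 \<le> ennreal (1 / e\<^sup>2) * ennreal ((norm y)\<^sup>2)}"
    proof (cases "norm y < e")
      case True
      then show ?thesis using e by auto
    next
      case False
      then have "1 \<le> 1 / e\<^sup>2 * (norm y)\<^sup>2" using e by (simp add: field_simps power_mono)
      then have "ennreal 1 \<le> ennreal (1 / e\<^sup>2) * ennreal ((norm y)\<^sup>2)"
        by (subst ennreal_mult[symmetric]) (auto intro!: ennreal_leI)
      then show ?thesis by (simp add: space)
    qed
  qed
  then have "emeasure \<nu> UNIV \<le> emeasure \<nu> (U \<union> {y\<in>space \<nu>. 1 \<le> ennreal (1 / e\<^sup>2) * ennreal ((norm y)\<^sup>2)})"
    using U by (intro emeasure_mono) auto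
  also have "\<dots> \<le> emeasure \<nu> U + emeasure \<nu> {y\<in>space \<nu>. 1 \<le> ennreal (1 / e\<^sup>2) * ennreal ((norm y)\<^sup>2)}"
    using U by (intro emeasure_subadditive) auto
  also have "emeasure \<nu> {y\<in>space \<nu>. 1 \<le> ennreal (1 / e\<^sup>2) * ennreal ((norm y)\<^sup>2)}
      \<le> ennreal (1 / e\<^sup>2) * (\<integral>\<^sup>+y. ennreal ((norm y)\<^sup>2) * indicator (space \<nu>) y \<partial>\<nu>)"
    by (intro nn_integral_Markov_inequality) auto
  also have "\<dots> < \<infinity>"
    using fin by (simp add: space ennreal_mult_less_top)
  finally show ?thesis using U by (simp add: ennreal_add_less_top)
qed

section \<open>Reduction to single coordinates by independence\<close>

theorem corollary3p4:
  fixes \<nu> :: "'y::real_normed_vector measure"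
    and n :: nat
    and P :: "(nat \<Rightarrow> 'y set) measure"
    and F :: "nat \<Rightarrow> 'y set \<Rightarrow> real"
    and R \<beta> l :: real
    and \<alpha>_sq :: ennreal
  assumes "n \<ge> 1" and "R > 0"
    and "radon_measure \<nu>" and "diffuse \<nu>"
    and "measure_support \<nu> \<subseteq> cball 0 R"
    and "prob_space P"
    and "sets P = sets (Pi\<^sub>M {1..n} (\<lambda>_. config_space))"
    and "prob_space.indep_vars P (\<lambda>_. config_space) (\<lambda>i \<omega>. \<omega> i) {1..n}"
    and "\<And>i. i \<in> {1..n} \<Longrightarrow> poisson_configuration P \<nu> (\<lambda>\<omega>. \<omega> i)"
    and "\<And>i. i \<in> {1..n} \<Longrightarrow> F i \<in> borel_measurable config_space"
    and "prob_space.indep_vars P (\<lambda>_. borel) (\<lambda>i \<omega>. F i (\<omega> i)) {1..n}"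
    and "\<And>i. i \<in> {1..n} \<Longrightarrow>
           distr P borel (\<lambda>\<omega>. F i (\<omega> i)) = distr P borel (\<lambda>\<omega>. F 1 (\<omega> 1))"
    and "\<beta> \<ge> 0" and "\<And>i. i \<in> {1..n} \<Longrightarrow> sup_gradient (F i) = ennreal \<beta>"
    and "\<alpha>_sq = (ennreal (8 * \<beta>^2) +
                 ennreal (2 * \<beta>^4 * R^2) / (\<integral>\<^sup>+\<omega>. ennreal \<bar>F 1 (\<omega> 1)\<bar> \<partial>P)^2)
               * (\<integral>\<^sup>+y. ennreal ((norm y)^2) \<partial>\<nu>)"
    and "0 < l" and "ennreal l < ennreal (\<beta>^2 * R^2) / (ennreal (exp 1) * \<alpha>_sq)"
  shows "(\<integral>\<^sup>+\<omega>. ennreal (exp (L2_set (\<lambda>i. F i (\<omega> i)) {1..n} / (\<beta> * R)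
            * log_plus (l * L2_set (\<lambda>i. F i (\<omega> i)) {1..n} / (\<beta> * R)))) \<partial>P) < \<infinity>"
proof -
  have R: "0 < R" and \<nu>: "radon_measure \<nu>" and l: "0 < l"
    and l_less: "ennreal l < ennreal (\<beta>\<^sup>2 * R\<^sup>2) / (ennreal (exp 1) * \<alpha>_sq)"
    by fact+
  interpret prob_space P by fact
  have sets: "sets \<nu> = sets borel" using \<nu> by (simp add: radon_measure_def)
  \<comment> \<open>For \<beta> = 0 the upper bound on \<open>l\<close> would be a quotient with
    numerator 0, hence 0.\<close>
  have \<beta>: "0 < \<beta>"
    using l_less \<open>0 \<le> \<beta>\<close> by (cases "\<beta> = 0") auto
  define I where "I = (\<integral>\<^sup>+y. ennreal ((norm y)\<^sup>2) \<partial>\<nu>)"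
  have \<alpha>: "ennreal (8 * \<beta>\<^sup>2) * I \<le> \<alpha>_sq"
    unfolding \<open>\<alpha>_sq = _\<close> I_def by (intro mult_right_mono) auto
  \<comment> \<open>An infinite second moment makes \<open>\<alpha>_sq\<close> infinite, and
    division by infinity in \<open>ennreal\<close> gives the upper bound 0 for
    \<open>l\<close>.\<close>
  have "I \<noteq> \<infinity>"
  proof
    assume "I = \<infinity>"
    then have "\<alpha>_sq = \<infinity>" using \<alpha> \<beta> by (simp add: ennreal_mult_top top_unique)
    then show False using l_less by (simp add: ennreal_mult_top)
  qed
  then obtain I2 where I2: "I = ennreal I2" "0 \<le> I2" by (cases I) auto
  have small: "8 * exp 1 * l * I2 < R\<^sup>2"
  proof (rule ccontr)
    assume "\<not> ?thesis"
    then have "\<beta>\<^sup>2 * R\<^sup>2 \<le> \<beta>\<^sup>2 * (8 * exp 1 * l * I2)" by (intro mult_left_mono) auto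
    also have "\<dots> = l * (exp 1 * (8 * \<beta>\<^sup>2 * I2))" by simp
    finally have "ennreal (\<beta>\<^sup>2 * R\<^sup>2) \<le> ennreal (l * (exp 1 * (8 * \<beta>\<^sup>2 * I2)))" by (rule ennreal_leI)
    also have "\<dots> = ennreal l * (ennreal (exp 1) * (ennreal (8 * \<beta>\<^sup>2) * I))"
      using l I2 by (simp add: ennreal_mult)
    also have "\<dots> \<le> ennreal l * (ennreal (exp 1) * \<alpha>_sq)"
      using \<alpha> by (intro mult_left_mono) auto
    finally have le: "ennreal (\<beta>\<^sup>2 * R\<^sup>2) \<le> ennreal l * (ennreal (exp 1) * \<alpha>_sq)" .
    \<comment> \<open>In \<open>ennreal\<close> a positive number divided by 0 is infinite, so the
      denominator has to be positive before \<open>le\<close> can be divided by it.\<close>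
    moreover have "0 < ennreal (\<beta>\<^sup>2 * R\<^sup>2)" using \<beta> R by simp
    ultimately have "0 < ennreal (exp 1) * \<alpha>_sq" by (cases "ennreal (exp 1) * \<alpha>_sq = 0") (auto simp: zero_less_iff_neq_zero)
    then have "ennreal (\<beta>\<^sup>2 * R\<^sup>2) / (ennreal (exp 1) * \<alpha>_sq) \<le> ennreal l"
      using le by (intro divide_le_posI_ennreal) (auto simp: mult.commute)
    then show False using l_less by simp
  qed
  (* A Radon measure may have infinite mass on a ball of an infinite-dimensional space. *)
  have "emeasure \<nu> UNIV < \<infinity>"
    using \<nu> \<open>I \<noteq> \<infinity>\<close> by (intro finite_if_second_moment_finite) (auto simp: I_def less_top)
  then obtain K where K: "emeasure \<nu> UNIV = ennreal K" "0 \<le> K"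
    by (cases "emeasure \<nu> UNIV") auto
  have ball: "emeasure \<nu> (- cball 0 R) = 0"
    using \<nu> \<open>measure_support \<nu> \<subseteq> cball 0 R\<close> by (intro radon_measure_compl_support_null) auto
  have zero: "emeasure \<nu> {0} = 0"
    using \<open>diffuse \<nu>\<close> by (simp add: diffuse_def)
  define X where "X i \<omega> = \<bar>F i (\<omega> i)\<bar> / (\<beta> * R)" for i and \<omega> :: "nat \<Rightarrow> 'y set"
  \<comment> \<open>The factor \<open>exp (1 / l)\<close> carries the additive constant that each
    coordinate contributes in \<open>L2_set_mult_log_plus_le\<close>. Thus the exponential of the
    sum is a product of functions of one coordinate each.\<close>
  define G where "G i \<omega> = ennreal (exp (1 / l)) * ennreal (exp (X i \<omega> * log_plus (exp 1 * l * X i \<omega>)))" for i \<omega>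
  have X0: "0 \<le> X i \<omega>" for i \<omega> using \<beta> R by (simp add: X_def)
  have L2: "L2_set (\<lambda>i. X i \<omega>) {1..n} = L2_set (\<lambda>i. F i (\<omega> i)) {1..n} / (\<beta> * R)" for \<omega>
    using \<beta> R by (simp add: L2_set_def X_def power_divide real_sqrt_divide real_sqrt_mult
        power_mult_distrib flip: sum_divide_distrib)
  have "(\<integral>\<^sup>+\<omega>. ennreal (exp (L2_set (\<lambda>i. F i (\<omega> i)) {1..n} / (\<beta> * R)
            * log_plus (l * L2_set (\<lambda>i. F i (\<omega> i)) {1..n} / (\<beta> * R)))) \<partial>P)
      \<le> (\<integral>\<^sup>+\<omega>. (\<Prod>i\<in>{1..n}. G i \<omega>) \<partial>P)"
  proof (rule nn_integral_mono)
    fix \<omega> :: "nat \<Rightarrow> 'y set"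
    have "L2_set (\<lambda>i. X i \<omega>) {1..n} * log_plus (l * L2_set (\<lambda>i. X i \<omega>) {1..n})
        \<le> (\<Sum>i\<in>{1..n}. X i \<omega> * log_plus (exp 1 * l * X i \<omega>) + 1 / l)"
      using X0 l by (intro L2_set_mult_log_plus_le) auto
    then have "ennreal (exp (L2_set (\<lambda>i. X i \<omega>) {1..n} * log_plus (l * L2_set (\<lambda>i. X i \<omega>) {1..n})))
        \<le> ennreal (exp (\<Sum>i\<in>{1..n}. X i \<omega> * log_plus (exp 1 * l * X i \<omega>) + 1 / l))"
      by (intro ennreal_leI) simp
    also have "\<dots> = (\<Prod>i\<in>{1..n}. G i \<omega>)"
      by (simp add: exp_sum exp_add G_def prod_ennreal ennreal_mult[symmetric] mult.commute)
    finally show "ennreal (exp (L2_set (\<lambda>i. F i (\<omega> i)) {1..n} / (\<beta> * R)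
            * log_plus (l * L2_set (\<lambda>i. F i (\<omega> i)) {1..n} / (\<beta> * R)))) \<le> (\<Prod>i\<in>{1..n}. G i \<omega>)"
      unfolding L2 by simp
  qed
  also have "\<dots> = (\<Prod>i\<in>{1..n}. \<integral>\<^sup>+\<omega>. G i \<omega> \<partial>P)"
  proof (intro indep_vars_nn_integral)
    have "indep_vars (\<lambda>_. borel) (\<lambda>i \<omega>. F i (\<omega> i)) {1..n}" by fact
    then show "indep_vars (\<lambda>_. borel) G {1..n}"
      unfolding G_def X_def log_plus_def by (rule indep_vars_compose2) simp
  qed auto
  also have "\<dots> < \<infinity>"
  proof -
    have "(\<integral>\<^sup>+\<omega>. G i \<omega> \<partial>P) \<noteq> \<infinity>" if i: "i \<in> {1..n}" for i
    proof -
      have [measurable]: "(\<lambda>\<omega>. F i (\<omega> i)) \<in> borel_measurable P"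
        using \<open>indep_vars (\<lambda>_. borel) (\<lambda>i \<omega>. F i (\<omega> i)) {1..n}\<close> i by (auto simp: indep_vars_def)
      have "(\<integral>\<^sup>+\<omega>. ennreal (exp (X i \<omega> * log_plus (exp 1 * l * X i \<omega>))) \<partial>P) < \<infinity>"
        unfolding X_def
      proof (rule exp_moment_poisson_functional_finite[OF _ sets K ball zero])
        show "poisson_configuration P \<nu> (\<lambda>\<omega>. \<omega> i)" using assms i by blast
        show "sup_gradient (F i) \<le> ennreal \<beta>" using assms i by simp
      qed (use I2 l small R \<beta> in \<open>auto simp: I_def\<close>)
      moreover have "(\<integral>\<^sup>+\<omega>. G i \<omega> \<partial>P) = ennreal (exp (1 / l))
          * (\<integral>\<^sup>+\<omega>. ennreal (exp (X i \<omega> * log_plus (exp 1 * l * X i \<omega>))) \<partial>P)"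
        unfolding G_def X_def log_plus_def by (intro nn_integral_cmult) simp
      ultimately show ?thesis by (simp add: ennreal_mult_eq_top_iff)
    qed
    then have "(\<Prod>i\<in>{1..n}. \<integral>\<^sup>+\<omega>. G i \<omega> \<partial>P) \<noteq> top"
      unfolding ennreal_prod_eq_top by auto
    then show ?thesis by (simp add: top.not_eq_extremum)
  qed
  finally show ?thesis .
qed

end
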